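(* Let $\lambda\ge 0$ and $t>0$, and let $\alpha_n=\alpha_n(t)$ and $\beta_n=\beta_n(t)$ be the recurrence coefficients of the monic orthogonal polynomials with respect to the weight $w(x;t)=x^{\lambda}e^{-x^2-t/x}$ on $(0,\infty)$. Then for every integer $n\ge 1$ the following two equations hold: $$ \begin{aligned} &\big[n t-2t\beta_n-2\alpha_n \beta_n(2\alpha_{n-1}^2+2 \beta_n+2 \beta_{n-1}-2 n+1-\lambda)-2\alpha_{n-1}\beta_n (2 \alpha_n^2+2 \beta_n+2 \beta_{n+1} -2 n-1-\lambda)\big]\\ &\times\big[(n+\lambda) t-2t\beta_n+2\alpha_n \beta_n(2\alpha_{n-1}^2+2 \beta_n+2 \beta_{n-1}-2 n+1-\lambda)+2\alpha_{n-1}\beta_n (2 \alpha_n^2+2 \beta_n+2 \beta_{n+1} -2 n-1-\lambda)\big]\\ &+\beta_n(2n+\lambda-4\beta_n)^2(2\alpha_{n-1}^2+2 \beta_n+2 \beta_{n-1}-2 n+1-\lambda)(2 \alpha_n^2+2 \beta_n+2 \beta_{n+1} -2 n-1-\lambda)=0 \end{aligned} $$ and $$ \begin{aligned} &2\big[n t-2t\beta_n-2\alpha_n \beta_n(2\alpha_{n-1}^2+2 \beta_n+2 \beta_{n-1}-2 n+1-\lambda)-2\alpha_{n-1}\beta_n (2 \alpha_n^2+2 \beta_n+2 \beta_{n+1} -2 n-1-\lambda)\big]\\ &+(2n+\lambda-4\beta_n)\big[2\alpha_n^3-(2n+2+\lambda)\alpha_n-t+4\alpha_n\beta_{n+1}-2\alpha_{n-1}\beta_n+2\alpha_{n+1}\beta_{n+1}\big]=0.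 \end{aligned} $$
   Context: Let $w(x;t)=x^{\lambda}e^{-x^2-t/x}$ for $x\in(0,\infty)$, with $\lambda\ge 0$, $t>0$. Let $P_n(x;t)$, $n=0,1,2,\ldots$, be the monic polynomials with $\deg P_n=n$ satisfying $\int_0^\infty P_m(x;t)P_n(x;t)w(x;t)\,dx=h_n(t)\delta_{mn}$ for all $m,n\ge 0$. They satisfy the three-term recurrence relation $$xP_n(x;t)=P_{n+1}(x;t)+\alpha_n(t)P_n(x;t)+\beta_n(t)P_{n-1}(x;t),\qquad n\ge 0,$$ with $P_0(x;t)=1$ and $\beta_0(t)P_{-1}(x;t)=0$. This defines the recurrence coefficients $\alpha_n(t)$ ($n\ge0$) and $\beta_n(t)$ ($n\ge 1$, with $\beta_n=h_n/h_{n-1}$). The convention $\beta_0=0$ is used. *)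

theory Defs
  imports "HOL-Analysis.Analysis" "HOL-Computational_Algebra.Polynomial"
begin

definition weight :: "real \<Rightarrow> real \<Rightarrow> real \<Rightarrow> real" where
  "weight lam t x = x powr lam * exp (- (x ^ 2) - t / x)"

(* The integrands are Lebesgue integrable on (0, \<infinity>) when lam \<ge> 0 and t > 0, so the
   integrals below never take the default value 0 of a non-integrable function. *)
definition monic_orthogonal_polys ::
    "real \<Rightarrow> real \<Rightarrow> (nat \<Rightarrow> real poly) \<Rightarrow> (nat \<Rightarrow> real) \<Rightarrow> bool" where
  "monic_orthogonal_polys lam t P h \<longleftrightarrow>
     (\<forall>n. degree (P n) = n \<and> lead_coeff (P n) = 1) \<and>
     (\<forall>m n. (LBINT x:{0<..}. poly (P m) x * poly (P n) x * weight lam t x) =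
            (if m = n then h n else 0))"

(* At n = 0 the index n - 1 is truncated to 0; the last summand is then the
   conventional beta_0 P_{-1} = 0, because \<beta> 0 = 0. *)
definition recurrence_coeffs ::
    "(nat \<Rightarrow> real poly) \<Rightarrow> (nat \<Rightarrow> real) \<Rightarrow> (nat \<Rightarrow> real) \<Rightarrow> bool" where
  "recurrence_coeffs P \<alpha> \<beta> \<longleftrightarrow>
     \<beta> 0 = 0 \<and>
     (\<forall>n x. x * poly (P n) x =
        poly (P (n + 1)) x + \<alpha> n * poly (P n) x + \<beta> n * poly (P (n - 1)) x)"

end

(* Besides the moments of the weight w one uses those of w / x: the auxiliary quantities are
   R_n = (t / h_n) * int P_n^2 w / x and r_n = (t / h_(n-1)) * int P_n P_(n-1) w / x.
   Expanding x P_n by the recurrence under the integral and integrating by parts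
   (x P_n^2 w)' and (x P_n P_(n-1) w)' expresses R_n, r_(n+1) + r_n and r_(n+1) - r_n through the
   recurrence coefficients. From these relations induction on n gives
     r_n (t - r_n) + beta_n R_n R_(n-1) = 0   and
     (2 n + lam - 4 beta_n) r_n = n t - 2 t beta_n - 2 beta_n (alpha_n R_(n-1) + alpha_(n-1) R_n),
   and the theorem is obtained by eliminating r_n. *)
theory Submission
  imports Defs "HOL-Real_Asymp.Real_Asymp"
begin

section \<open>Bounds and integrability of the weight and of its quotient by x\<close>

lemma weight_nonneg: "0 \<le> weight lam t x"
  by (simp add: weight_def)

lemma weight_pos: "x > 0 \<Longrightarrow> 0 < weight lam t x"
  by (simp add: weight_def)

text \<open>Trades the Gaussian for \<open>exp (- x)\<close>, so that integrands of the Gamma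
  function can serve as majorants. Completing the square would even give 1/4 in place of 1.\<close>

lemma exp_neg_square_le: "exp (- (x\<^sup>2)) \<le> exp 1 * exp (- x)" for x :: real
proof -
  have "0 \<le> (x - 1/2)\<^sup>2" by simp
  then have "- (x\<^sup>2) \<le> 1 - x" by (simp add: power2_eq_square algebra_simps)
  then show ?thesis by (simp flip: exp_add)
qed

lemma weight_le:
  assumes "t > 0" "x > 0"
  shows "weight lam t x \<le> exp 1 * (x powr lam / exp x)"
proof -
  have "exp (- (x\<^sup>2) - t / x) \<le> exp (- (x\<^sup>2))" using assms by simp
  also have "\<dots> \<le> exp 1 * exp (- x)" by (rule exp_neg_square_le)
  finally show ?thesis
    unfolding weight_def using mult_left_mono[of _ _ "x powr lam"]
    by (fastforce simp: exp_minus field_simps)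
qed

text \<open>The factor \<^term>\<open>exp (- t / x)\<close> absorbs the singularity at the origin, since \<^prop>\<open>u \<le> exp u\<close>.\<close>
lemma weight_divide_le:
  assumes "t > 0" "x > 0"
  shows "weight lam t x / x \<le> exp 1 / t * (x powr lam / exp x)"
proof -
  have "t / x \<le> exp (t / x)" using exp_ge_add_one_self[of "t / x"] by linarith
  then have "exp (- (t / x)) \<le> x / t"
    using assms by (simp add: exp_minus field_simps)
  then have "exp (- (x\<^sup>2)) * exp (- (t / x)) \<le> exp 1 * exp (- x) * (x / t)"
    using exp_neg_square_le assms by (intro mult_mono) auto
  then have "weight lam t x \<le> x powr lam * (exp 1 * exp (- x) * (x / t))"
    unfolding weight_def diff_conv_add_uminus exp_add by (rule mult_left_mono) simp
  then show ?thesis using assms by (simp add: field_simps exp_minus)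
qed

lemma weight_measurable [measurable]: "weight lam t \<in> borel_measurable borel"
  unfolding weight_def[abs_def] by measurable

text \<open>This is the integrand of Gamma(a + 1). Nonnegativity turns the gauge integral into an
  absolute one, and Borel measurability allows passing from the completed measure to
  \<open>lborel\<close>.\<close>

lemma set_integrable_powr_div_exp:
  fixes a :: real assumes "a \<ge> 0"
  shows "set_integrable lborel {0<..} (\<lambda>x. x powr a / exp x)"
proof -
  have "((\<lambda>t. t powr a / exp t) has_integral Gamma (a + 1)) {0..}"
    using Gamma_integral_real[of "a + 1"] assms by simp
  then have "(\<lambda>t. t powr a / exp t) absolutely_integrable_on {0..}"
    by (intro nonnegative_absolutely_integrable_1) (auto simp: has_integral_iff)
  then have "set_integrable lborel {0..} (\<lambda>t. t powr a / exp t)"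
    unfolding set_integrable_def by (subst (asm) integrable_completion) auto
  then show ?thesis by (rule set_integrable_subset) auto
qed

lemma set_integrable_poly_weight_divide:
  assumes "lam \<ge> 0" "t > 0"
  shows "set_integrable lborel {0<..} (\<lambda>x. poly p x * (weight lam t x / x))"
proof -
  have mono: "set_integrable lborel {0<..} (\<lambda>x. x ^ k * (weight lam t x / x))" for k
  proof (rule set_integrable_bound)
    show "set_integrable lborel {0<..} (\<lambda>x. exp 1 / t * (x powr (lam + real k) / exp x))"
      using assms by (intro set_integrable_mult_right set_integrable_powr_div_exp) auto
    show "set_borel_measurable lborel {0<..} (\<lambda>x. x ^ k * (weight lam t x / x))"
      unfolding set_borel_measurable_def by measurable
    show "AE x in lborel. x \<in> {0<..} \<longrightarrow> norm (x ^ k * (weight lam t x / x))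
        \<le> norm (exp 1 / t * (x powr (lam + real k) / exp x))"
    proof (intro AE_I2 impI)
      fix x :: real assume "x \<in> {0<..}"
      then have x: "x > 0" by simp
      have "x ^ k * (weight lam t x / x) \<le> x ^ k * (exp 1 / t * (x powr lam / exp x))"
        using weight_divide_le[OF assms(2) x] x by (intro mult_left_mono) auto
      also have "\<dots> = exp 1 / t * (x powr (lam + real k) / exp x)"
        using x by (simp add: powr_add powr_realpow)
      finally show "norm (x ^ k * (weight lam t x / x))
          \<le> norm (exp 1 / t * (x powr (lam + real k) / exp x))"
        using x assms weight_nonneg[of lam t x] by simp
    qed
  qed
  \<comment> \<open>The free factor \<open>x ^ k\<close> strengthens the induction:
    \<open>pCons a p\<close> splits into a monomial part and \<open>x ^ Suc k\<close> times
    \<open>p\<close>.\<close>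
  have "set_integrable lborel {0<..} (\<lambda>x. x ^ k * poly p x * (weight lam t x / x))" for k
  proof (induction p arbitrary: k)
    case 0
    then show ?case by (simp add: set_integrable_def)
  next
    case (pCons a p)
    have "set_integrable lborel {0<..} (\<lambda>x. a * (x ^ k * (weight lam t x / x)) +
        x ^ Suc k * poly p x * (weight lam t x / x))"
      by (intro set_integral_add set_integrable_mult_right mono pCons.IH)
    then show ?case by (simp add: algebra_simps)
  qed
  from this[of 0] show ?thesis by simp
qed

lemma set_integrable_poly_weight:
  assumes "lam \<ge> 0" "t > 0"
  shows "set_integrable lborel {0<..} (\<lambda>x. poly p x * weight lam t x)"
proof -
  have "set_integrable lborel {0<..} (\<lambda>x. poly (pCons 0 p) x * (weight lam t x / x))"
    by (rule set_integrable_poly_weight_divide[OF assms])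
  then show ?thesis
    by (rule set_integrable_cong[THEN iffD1, rotated -1]) auto
qed

section \<open>Vanishing of the boundary terms at 0 and at infinity\<close>

text \<open>The filter is left open to serve both ends of the half-line: \<open>weight_le\<close>
  reduces either limit to that of a power over \<open>exp x\<close>, monomial by monomial.\<close>

lemma tendsto_poly_weight:
  assumes lim: "\<And>k. ((\<lambda>x. x powr (lam + real k) * x / exp x) \<longlongrightarrow> 0) F"
    and F: "eventually (\<lambda>x. x > 0) F" and t: "t > 0"
  shows "((\<lambda>x. x * poly p x * weight lam t x) \<longlongrightarrow> 0) F"
proof -
  have mono: "((\<lambda>x. x ^ k * (x * weight lam t x)) \<longlongrightarrow> 0) F" for k
  proof (rule Lim_null_comparison)
    show "((\<lambda>x. exp 1 * (x powr (lam + real k) * x / exp x)) \<longlongrightarrow> 0) F"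
      by (rule tendsto_mult_right_zero[OF lim])
    show "\<forall>\<^sub>F x in F. norm (x ^ k * (x * weight lam t x))
        \<le> exp 1 * (x powr (lam + real k) * x / exp x)"
      using F
    proof eventually_elim
      case (elim x)
      have "(x ^ k * x) * weight lam t x \<le> (x ^ k * x) * (exp 1 * (x powr lam / exp x))"
        using weight_le[OF t elim] elim by (intro mult_left_mono) auto
      then show ?case
        using elim weight_nonneg[of lam t x] by (simp add: powr_add powr_realpow mult_ac)
    qed
  qed
  have "((\<lambda>x. x ^ k * poly p x * (x * weight lam t x)) \<longlongrightarrow> 0) F" for k
  proof (induction p arbitrary: k)
    case 0
    then show ?case by simp
  next
    case (pCons a p)
    have "((\<lambda>x. a * (x ^ k * (x * weight lam t x)) +
        x ^ Suc k * poly p x * (x * weight lam t x)) \<longlongrightarrow> a * 0 + 0) F"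
      by (intro tendsto_intros mono pCons.IH)
    then show ?case by (simp add: algebra_simps)
  qed
  from this[of 0] show ?thesis by (simp add: mult_ac)
qed

lemma tendsto_poly_weight_at_top:
  assumes "t > 0"
  shows "((\<lambda>x. x * poly p x * weight lam t x) \<longlongrightarrow> 0) at_top"
proof (rule tendsto_poly_weight)
  show "((\<lambda>x. x powr (lam + real k) * x / exp x) \<longlongrightarrow> 0) at_top" for k
  proof -
    define a where "a = lam + real k"
    show ?thesis unfolding a_def[symmetric] by real_asymp
  qed
qed (use assms eventually_gt_at_top in auto)

lemma tendsto_poly_weight_at_right_0:
  assumes "lam \<ge> 0" "t > 0"
  shows "((\<lambda>x. x * poly p x * weight lam t x) \<longlongrightarrow> 0) (at_right 0)"
proof (rule tendsto_poly_weight)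
  show "((\<lambda>x. x powr (lam + real k) * x / exp x) \<longlongrightarrow> 0) (at_right 0)" for k
  proof -
    define a where "a = lam + real k"
    have "a \<ge> 0" using assms by (simp add: a_def)
    show ?thesis unfolding a_def[symmetric]
    proof (rule Lim_null_comparison)
      show "((\<lambda>x::real. x) \<longlongrightarrow> 0) (at_right 0)" by (rule tendsto_ident_at)
      \<comment> \<open>On (0, 1) both \<open>x powr a\<close> and \<open>1 / exp x\<close> are at
        most 1, because a \<ge> 0; the remaining factor x forces the limit 0.\<close>
      show "\<forall>\<^sub>F x in at_right 0. norm (x powr a * x / exp x) \<le> x"
        using eventually_at_right_real[of 0 1, simplified]
      proof eventually_elim
        case (elim x)
        then have "x powr a \<le> 1" using \<open>a \<ge> 0\<close> by (simp add: powr_le1)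
        then have "x powr a * x \<le> 1 * x" using elim by (intro mult_right_mono) auto
        also have "\<dots> \<le> x * exp x" using elim by simp
        finally show ?case using elim by (simp add: field_simps)
      qed
    qed
  qed
qed (use assms in \<open>auto simp: eventually_at_right_less\<close>)

lemma weight_has_real_derivative:
  assumes "x > 0"
  shows "(weight lam t has_real_derivative (lam / x + t / x\<^sup>2 - 2 * x) * weight lam t x) (at x)"
  unfolding weight_def[abs_def] using assms
  by (auto intro!: derivative_eq_intros simp: field_simps powr_diff power2_eq_square)

section \<open>The two moment functionals, positivity, and integration by parts\<close>

definition weight_moment :: "real \<Rightarrow> real \<Rightarrow> real poly \<Rightarrow> real" where
  "weight_moment lam t p = (LBINT x:{0<..}. poly p x * weight lam t x)"

definition weight_divide_moment :: "real \<Rightarrow> real \<Rightarrow> real poly \<Rightarrow> real" where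
  "weight_divide_moment lam t p = (LBINT x:{0<..}. poly p x * (weight lam t x / x))"

lemma weight_moment_add:
  assumes "lam \<ge> 0" "t > 0"
  shows "weight_moment lam t (p + q) = weight_moment lam t p + weight_moment lam t q"
  unfolding weight_moment_def poly_add distrib_right
  by (intro set_integral_add set_integrable_poly_weight assms)

lemma weight_moment_smult: "weight_moment lam t (smult c p) = c * weight_moment lam t p"
  by (simp add: weight_moment_def mult.assoc)

lemma weight_divide_moment_add:
  assumes "lam \<ge> 0" "t > 0"
  shows "weight_divide_moment lam t (p + q) =
    weight_divide_moment lam t p + weight_divide_moment lam t q"
  unfolding weight_divide_moment_def poly_add distrib_right
  by (intro set_integral_add set_integrable_poly_weight_divide assms)

lemma weight_divide_moment_smult:
  "weight_divide_moment lam t (smult c p) = c * weight_divide_moment lam t p"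
  using set_integral_mult_right[of lborel "{0<..}" c "\<lambda>x. poly p x * (weight lam t x / x)"]
  by (simp add: weight_divide_moment_def mult.assoc)

lemma weight_divide_moment_pCons_0: "weight_divide_moment lam t (pCons 0 p) = weight_moment lam t p"
  unfolding weight_divide_moment_def weight_moment_def
  by (rule set_lebesgue_integral_cong) auto

text \<open>Needed for \<open>h n\<close> to be nonzero. The weight is strictly positive, so the
  integrand vanishes only at the finitely many roots of p.\<close>

lemma weight_moment_square_pos:
  assumes "lam \<ge> 0" "t > 0" "p \<noteq> 0"
  shows "weight_moment lam t (p * p) > 0"
proof -
  let ?f = "\<lambda>x. indicator {0<..} x *\<^sub>R (poly (p * p) x * weight lam t x)"
  have int: "integrable lborel ?f"
    using set_integrable_poly_weight[OF assms(1,2), of "p * p"] by (simp add: set_integrable_def)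
  have nn: "AE x in lborel. 0 \<le> ?f x"
    by (auto simp: indicator_def weight_nonneg)
  have "\<not> (AE x in lborel. ?f x = 0)"
  proof
    assume "AE x in lborel. ?f x = 0"
    moreover have "AE x in lborel. x \<notin> {x. poly p x = 0}"
      using poly_roots_finite[OF assms(3)]
      by (intro AE_not_in finite_imp_null_set_lborel)
    \<comment> \<open>Any subset of the half-line of positive measure would do; (0, 1) is a
      convenient choice.\<close>
    ultimately have "AE x in lborel. x \<notin> {0<..<1::real}"
    proof eventually_elim
      case (elim x)
      then show ?case using weight_pos[of x lam t] by auto
    qed
    then have "{0<..<1::real} \<in> null_sets lborel"
      by (subst (asm) AE_iff_null_sets[symmetric]) auto
    then show False by auto
  qed
  then have "integral\<^sup>L lborel ?f \<noteq> 0"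
    using integral_nonneg_eq_0_iff_AE[OF int nn] by simp
  moreover have "integral\<^sup>L lborel ?f \<ge> 0" using nn by (rule integral_nonneg_AE)
  ultimately show ?thesis by (simp add: weight_moment_def set_lebesgue_integral_def)
qed

text \<open>Integrate the derivative of x q w over the half-line: x w' = (lam + t/x - 2 x^2) w, and
  the boundary values are 0. The term t/x is what brings in the second functional.\<close>

lemma weight_moment_by_parts:
  assumes "lam \<ge> 0" "t > 0"
  shows "weight_moment lam t (q + pCons 0 (pderiv q)) =
    2 * weight_moment lam t (pCons 0 (pCons 0 q)) - lam * weight_moment lam t q
      - t * weight_divide_moment lam t q"
proof -
  \<comment> \<open>\<open>u\<close> collects the polynomial factor of w in the derivative of x q w;
    the rest of that derivative is t q w / x.\<close>
  define u where "u = q + pCons 0 (pderiv q) + smult (-2) (pCons 0 (pCons 0 q)) + smult lam q"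
  define f where "f x = poly u x * weight lam t x + t * (poly q x * (weight lam t x / x))" for x
  have int: "set_integrable lborel {0<..} (\<lambda>x. poly u x * weight lam t x)"
    "set_integrable lborel {0<..} (\<lambda>x. t * (poly q x * (weight lam t x / x)))"
    by (intro set_integrable_mult_right set_integrable_poly_weight set_integrable_poly_weight_divide assms)+
  have "(LBINT x=0..\<infinity>. f x) = 0 - 0"
  proof (rule interval_integral_FTC_integrable[where F = "\<lambda>x. x * poly q x * weight lam t x"])
    fix x :: real assume "0 < ereal x"
    then have x: "x > 0" by simp
    have "((\<lambda>x. x * poly q x * weight lam t x) has_real_derivative f x) (at x)"
      using x unfolding f_def u_def
      by (auto intro!: derivative_eq_intros weight_has_real_derivative
          simp: field_simps power2_eq_square)
    then show "((\<lambda>x. x * poly q x * weight lam t x) has_vector_derivative f x) (at x)"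
      by (simp add: has_real_derivative_iff_has_vector_derivative)
    have "isCont (weight lam t) x" using weight_has_real_derivative[OF x] by (rule DERIV_isCont)
    then show "isCont f x"
      unfolding f_def using x by (intro continuous_intros) auto
  next
    show "set_integrable lborel (einterval 0 \<infinity>) f"
      unfolding f_def zero_ereal_def einterval_eq using int by (rule set_integral_add)
  next
    show "(((\<lambda>x. x * poly q x * weight lam t x) \<circ> real_of_ereal) \<longlongrightarrow> 0) (at_right 0)"
      using tendsto_poly_weight_at_right_0[OF assms]
      by (simp add: zero_ereal_def ereal_tendsto_simps)
    show "(((\<lambda>x. x * poly q x * weight lam t x) \<circ> real_of_ereal) \<longlongrightarrow> 0) (at_left \<infinity>)"
      using tendsto_poly_weight_at_top[OF assms(2)] by (simp add: ereal_tendsto_simps)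
  qed simp
  then have "(LBINT x:{0<..}. f x) = 0"
    by (simp add: interval_lebesgue_integral_def zero_ereal_def)
  then have "weight_moment lam t u + t * weight_divide_moment lam t q = 0"
    unfolding f_def using int
    by (simp add: set_integral_add weight_moment_def weight_divide_moment_def
        del: times_divide_eq_right)
  then show ?thesis
    unfolding u_def weight_moment_add[OF assms] weight_moment_smult by simp
qed

section \<open>Induction from the ladder relations to the quadratic and the linear identity\<close>

lemma ladder_step:
  fixes \<alpha> \<beta> R r :: "nat \<Rightarrow> real"
  assumes "\<beta> 0 = 0" "r 0 = 0"
    and R: "\<And>n. R n = 2 * (\<alpha> n)\<^sup>2 + 2 * \<beta> n + 2 * \<beta> (n + 1) - 2 * real n - 1 - lam"
    and S1: "\<And>n. r (n + 1) + r n = t - \<alpha> n * R n"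
    and S2: "\<And>n. \<beta> (n + 1) * R (n + 1) + \<alpha> n * (r (n + 1) - r n) = \<beta> n * R (n - 1)"
    and D: "\<And>n. r (n + 1) - r n =
       2 * \<beta> (n + 1) * (\<alpha> (n + 1) + \<alpha> n) - 2 * \<beta> n * (\<alpha> n + \<alpha> (n - 1)) - \<alpha> n"
  shows "r n * (t - r n) + \<beta> n * R n * R (n - 1) = 0"
    and "r n * (2 * real n + lam - 4 * \<beta> n) =
      real n * t - 2 * t * \<beta> n - 2 * \<alpha> n * \<beta> n * R (n - 1) - 2 * \<alpha> (n - 1) * \<beta> n * R n"
proof -
  show "r n * (t - r n) + \<beta> n * R n * R (n - 1) = 0"
  proof (induction n)
    case 0 then show ?case using assms by simp
  next
    \<comment> \<open>The left-hand side does not change from n to n + 1: multiply the second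
      relation by \<open>R n\<close> and rewrite both \<open>t - r n\<close> and
      \<open>t - r (n + 1)\<close> by the first.\<close>
    case (Suc n)
    then show ?case using S1[of n] S2[of n] by simp algebra
  qed
  show "r n * (2 * real n + lam - 4 * \<beta> n) =
      real n * t - 2 * t * \<beta> n - 2 * \<alpha> n * \<beta> n * R (n - 1) - 2 * \<alpha> (n - 1) * \<beta> n * R n"
  proof (induction n)
    case 0 then show ?case using assms by simp
  next
    \<comment> \<open>The difference of the two sides is also constant in n: after using
      \<open>S1\<close>, \<open>S2\<close> and \<open>D\<close>, its increment is
      \<open>r (n + 1) - r n\<close> times the two sides of \<open>R\<close> subtracted.\<close>
    case (Suc n)
    then show ?case using S1[of n] S2[of n] D[of n] R[of n] by simp algebra
  qed
qed

section \<open>Orthogonal polynomials for an abstract pair of functionals\<close>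

text \<open>\<open>M\<close> and \<open>N\<close> stand for integration against w and w / x. Once
  integration by parts is assumed, the ladder relations are pure algebra.\<close>

locale orthogonal_moments =
  fixes M N :: "real poly \<Rightarrow> real" and lam t :: real
    and P :: "nat \<Rightarrow> real poly" and h \<alpha> \<beta> :: "nat \<Rightarrow> real"
  assumes M_add: "M (p + q) = M p + M q" and M_smult: "M (smult c p) = c * M p"
    and N_add: "N (p + q) = N p + N q" and N_smult: "N (smult c p) = c * N p"
    and N_pCons_0: "N (pCons 0 p) = M p"
    and by_parts: "M (p + pCons 0 (pderiv p)) = 2 * M (pCons 0 (pCons 0 p)) - lam * M p - t * N p"
    and degree_P: "degree (P n) = n" and monic_P: "lead_coeff (P n) = 1"
    and orthogonal: "M (P m * P n) = (if m = n then h n else 0)"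
    and h_nonzero: "h n \<noteq> 0"
    and \<beta>_0: "\<beta> 0 = 0"
    and recurrence: "pCons 0 (P n) = P (n + 1) + smult (\<alpha> n) (P n) + smult (\<beta> n) (P (n - 1))"
begin

text \<open>Peel off the top coefficient of q with a multiple of \<open>P m\<close>, which is
  orthogonal to \<open>P n\<close> as m < n. Bounding coefficients instead of the degree lets q = 0
  be the base case.\<close>

lemma M_mult_eq_0:
  assumes "\<And>i. i \<ge> m \<Longrightarrow> coeff q i = 0" "m \<le> n"
  shows "M (q * P n) = 0"
  using assms
proof (induction m arbitrary: q)
  case 0
  then have "q = 0" by (simp add: poly_eq_iff)
  then show ?case using M_smult[of 0 0] by simp
next
  case (Suc m)
  define q' where "q' = q + smult (- coeff q m) (P m)"
  have "M (q' * P n) = 0"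
  proof (rule Suc.IH)
    fix i assume "i \<ge> m"
    then show "coeff q' i = 0"
      using Suc.prems(1)[of i] degree_P[of m] monic_P[of m] coeff_eq_0[of "P m" i]
      by (cases "i = m") (auto simp: q'_def)
  qed (use Suc.prems in simp)
  moreover have "q = q' + smult (coeff q m) (P m)" by (simp add: q'_def)
  then have "M (q * P n) = M (q' * P n) + coeff q m * M (P m * P n)"
    by (metis M_add M_smult distrib_right mult_smult_left)
  ultimately show ?case using orthogonal[of m n] Suc.prems(2) by simp
qed

lemma M_mult:
  assumes "degree q \<le> n"
  shows "M (q * P n) = coeff q n * h n"
proof -
  define q' where "q' = q + smult (- coeff q n) (P n)"
  have "M (q' * P n) = 0"
  proof (rule M_mult_eq_0[of n])
    fix i assume "i \<ge> n"
    then show "coeff q' i = 0"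
      using assms degree_P[of n] monic_P[of n] coeff_eq_0[of "P n" i] coeff_eq_0[of q i]
      by (cases "i = n") (auto simp: q'_def)
  qed simp
  moreover have "q = q' + smult (coeff q n) (P n)" by (simp add: q'_def)
  then have "M (q * P n) = M (q' * P n) + coeff q n * M (P n * P n)"
    by (metis M_add M_smult distrib_right mult_smult_left)
  ultimately show ?thesis by (simp add: orthogonal)
qed

lemma M_recurrence:
  "M (pCons 0 (P n * q)) = M (P (n + 1) * q) + \<alpha> n * M (P n * q) + \<beta> n * M (P (n - 1) * q)"
proof -
  have "pCons 0 (P n * q) = pCons 0 (P n) * q" by simp
  then show ?thesis unfolding recurrence by (simp only: distrib_right M_add M_smult mult_smult_left)
qed

lemma N_recurrence:
  "M (P n * q) = N (P (n + 1) * q) + \<alpha> n * N (P n * q) + \<beta> n * N (P (n - 1) * q)"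
proof -
  have "M (P n * q) = N (pCons 0 (P n) * q)" by (simp add: N_pCons_0)
  then show ?thesis
    unfolding recurrence by (simp only: distrib_right N_add N_smult mult_smult_left)
qed

text \<open>Evaluate \<open>M\<close> of x P_n P_(n+1) twice, expanding x P_(n+1) and then x
  P_n.\<close>

lemma h_Suc: "h (n + 1) = \<beta> (n + 1) * h n"
proof -
  have "pCons 0 (P (n + 1) * P n) = pCons 0 (P n * P (n + 1))" by (simp add: mult.commute)
  then show ?thesis
    using M_recurrence[of "n + 1" "P n"] M_recurrence[of n "P (n + 1)"]
    by (simp add: orthogonal mult.commute split: if_splits)
qed

lemma \<beta>_Suc_nonzero: "\<beta> (n + 1) \<noteq> 0"
  using h_Suc[of n] h_nonzero[of "n + 1"] by auto

section \<open>The auxiliary quantities and their relations\<close>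

definition R :: "nat \<Rightarrow> real" where "R n = t * N (P n * P n) / h n"

text \<open>For n \<ge> 1 this is t N(P_n P_(n-1)) / h_(n-1), by \<open>h_Suc\<close>. Writing it
  with \<open>\<beta> n / h n\<close> makes it 0 at n = 0, where n - 1 is truncated.\<close>

definition r :: "nat \<Rightarrow> real" where "r n = t * \<beta> n * N (P n * P (n - 1)) / h n"

lemma r_0: "r 0 = 0"
  by (simp add: r_def \<beta>_0)

lemma r_Suc: "r (n + 1) = t * N (P (n + 1) * P n) / h n"
  using \<beta>_Suc_nonzero[of n] by (simp add: r_def h_Suc[simplified])

text \<open>Write h_n as \<open>N\<close> of (x P_n) P_n and expand x P_n.\<close>

lemma r_Suc_add: "r (n + 1) + r n = t - \<alpha> n * R n"
proof -
  have "h n = N (P (n + 1) * P n) + \<alpha> n * N (P n * P n) + \<beta> n * N (P n * P (n - 1))"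
    using N_recurrence[of n "P n"] by (simp add: orthogonal mult.commute)
  then have "t = t * (N (P (n + 1) * P n) + \<alpha> n * N (P n * P n) + \<beta> n * N (P n * P (n - 1))) / h n"
    using h_nonzero[of n] by simp
  then show ?thesis
    unfolding r_Suc unfolding R_def r_def by (simp add: algebra_simps add_divide_distrib)
qed

text \<open>Expanding x P_n against P_(n+1) and against P_(n-1) under \<open>N\<close> gives 0 both
  times; eliminate the common value N(P_(n+1) P_(n-1)).\<close>

lemma R_Suc: "\<beta> (n + 1) * R (n + 1) + \<alpha> n * (r (n + 1) - r n) = \<beta> n * R (n - 1)"
proof -
  have "N (P (n + 1) * P (n + 1)) + \<alpha> n * N (P (n + 1) * P n) + \<beta> n * N (P (n - 1) * P (n + 1)) = 0"
    using N_recurrence[of n "P (n + 1)"] by (simp add: orthogonal mult.commute)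
  moreover have "\<beta> (n + 1) * R (n + 1) = t * N (P (n + 1) * P (n + 1)) / h n"
    using \<beta>_Suc_nonzero[of n] by (simp add: R_def h_Suc[simplified])
  ultimately have 1: "\<beta> (n + 1) * R (n + 1) + \<alpha> n * r (n + 1) =
      - (t * \<beta> n * N (P (n - 1) * P (n + 1)) / h n)"
    unfolding r_Suc using h_nonzero[of n] by (simp add: field_simps) algebra
  show ?thesis
  proof (cases n)
    case 0
    then show ?thesis using 1 by (simp add: r_0 \<beta>_0)
  next
    case (Suc m)
    have *: "\<beta> n * N (P m * P m) + \<alpha> n * N (P n * P m) = - N (P (n + 1) * P m)"
      using N_recurrence[of n "P m"] Suc by (simp add: orthogonal)
    have "\<beta> n * R m = t * \<beta> n * (\<beta> n * N (P m * P m)) / h n"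
      using h_Suc[of m] h_nonzero[of m] \<beta>_Suc_nonzero[of m] Suc by (simp add: R_def)
    then have "\<beta> n * R m + \<alpha> n * r n =
        t * \<beta> n * (\<beta> n * N (P m * P m) + \<alpha> n * N (P n * P m)) / h n"
      using Suc by (simp add: r_def algebra_simps add_divide_distrib)
    also have "\<dots> = - (t * \<beta> n * N (P (n + 1) * P m) / h n)"
      unfolding * by simp
    finally have "\<beta> n * R m + \<alpha> n * r n = - (t * \<beta> n * N (P (n + 1) * P m) / h n)" .
    then show ?thesis using 1 Suc by (simp add: mult.commute algebra_simps)
  qed
qed

text \<open>Integration by parts with q = P_n^2. The derivative contributes 2 n h_n, since x P_n'
  has leading term n x^n; the norm of x P_n follows from the recurrence.\<close>

lemma R_eq: "R n = 2 * (\<alpha> n)\<^sup>2 + 2 * \<beta> n + 2 * \<beta> (n + 1) - 2 * real n - 1 - lam"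
proof -
  have deg: "degree (pCons 0 (pderiv (P n))) \<le> n"
    using degree_P[of n] by (cases n) (auto simp: degree_pCons_eq_if degree_pderiv pderiv_eq_0_iff)
  have "coeff (P n) n = 1" using monic_P[of n] degree_P[of n] by simp
  then have "coeff (pCons 0 (pderiv (P n))) n = real n"
    by (cases n) (auto simp: coeff_pderiv)
  with deg have D: "M (pCons 0 (pderiv (P n)) * P n) = real n * h n"
    by (simp only: M_mult)
  have "P n * P n + pCons 0 (pderiv (P n * P n)) =
      P n * P n + (pCons 0 (pderiv (P n)) * P n + pCons 0 (pderiv (P n)) * P n)"
    by (simp add: pderiv_mult mult.commute)
  then have "M (P n * P n + pCons 0 (pderiv (P n * P n))) = (2 * real n + 1) * h n"
    by (simp only: M_add D) (simp add: orthogonal algebra_simps)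
  moreover have "M (pCons 0 (pCons 0 (P n * P n))) = ((\<alpha> n)\<^sup>2 + \<beta> n + \<beta> (n + 1)) * h n"
  proof -
    have "pCons 0 (pCons 0 (P n * P n)) = pCons 0 (P n * pCons 0 (P n))" by simp
    also have "M \<dots> = M (pCons 0 (P n * P (n + 1))) + \<alpha> n * M (pCons 0 (P n * P n))
        + \<beta> n * M (pCons 0 (P n * P (n - 1)))"
      using M_recurrence[of n "pCons 0 (P n)"] by (simp add: mult.commute)
    also have "\<dots> = ((\<alpha> n)\<^sup>2 + \<beta> n + \<beta> (n + 1)) * h n"
      using h_Suc[of n] h_Suc[of "n - 1"] \<beta>_0
      by (cases n) (simp_all add: M_recurrence orthogonal power2_eq_square algebra_simps)
    finally show ?thesis .
  qed
  moreover have "t * N (P n * P n) = R n * h n" using h_nonzero[of n] by (simp add: R_def)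
  ultimately have "(2 * real n + 1) * h n =
      (2 * ((\<alpha> n)\<^sup>2 + \<beta> n + \<beta> (n + 1)) - lam - R n) * h n"
    using by_parts[of "P n * P n"] by (simp add: orthogonal algebra_simps)
  then show ?thesis using h_nonzero[of n] by simp
qed

text \<open>At n = 0 the truncated index would pick the leading coefficient 1, so 0 is prescribed;
  then \<open>subleading n\<close> is minus the sum of the \<alpha> k with k < n.\<close>

definition subleading :: "nat \<Rightarrow> real" where
  "subleading n = (if n = 0 then 0 else coeff (P n) (n - 1))"

lemma subleading_Suc: "subleading (n + 1) = subleading n - \<alpha> n"
proof -
  have "coeff (pCons 0 (P n)) n = coeff (P (n + 1)) n + \<alpha> n + \<beta> n * coeff (P (n - 1)) n"
    unfolding recurrence using monic_P[of n] degree_P[of n] by simp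
  \<comment> \<open>For n \<ge> 1 the degree is too small; for n = 0 the truncated index gives
    coefficient 1, which \<beta> 0 = 0 cancels.\<close>
  moreover have "\<beta> n * coeff (P (n - 1)) n = 0"
    using \<beta>_0 degree_P[of "n - 1"] by (cases n) (auto intro: coeff_eq_0)
  ultimately show ?thesis by (cases n) (simp_all add: subleading_def \<beta>_0)
qed

text \<open>Integration by parts with q = P_n P_(n-1). Only x P_n' P_(n-1) survives from the
  derivative terms, and it produces the subleading coefficient, which \<open>r_Suc_diff\<close> then
  removes.\<close>

lemma r_eq: "r n = subleading n + 2 * \<beta> n * (\<alpha> n + \<alpha> (n - 1))"
proof (cases n)
  case 0
  then show ?thesis by (simp add: r_0 \<beta>_0 subleading_def)
next
  case (Suc m)
  have lead: "coeff (P k) k = 1" for k using monic_P[of k] degree_P[of k] by simp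
  have "degree (pCons 0 (pderiv (P m))) \<le> m"
    using degree_P[of m] by (cases m) (auto simp: degree_pCons_eq_if degree_pderiv pderiv_eq_0_iff)
  then have D1: "M (pCons 0 (pderiv (P m)) * P n) = 0"
    using Suc by (intro M_mult_eq_0[of n]) (auto intro: coeff_eq_0)
  \<comment> \<open>Subtracting n P_n cancels the leading term of x P_n'; the coefficient of x^(n-1)
    becomes (n - 1) - n = -1 times \<open>subleading n\<close>.\<close>
  define q where "q = pCons 0 (pderiv (P n)) + smult (- real n) (P n)"
  have "coeff q m = - subleading n"
    using Suc by (cases m) (auto simp: q_def subleading_def coeff_pderiv algebra_simps)
  moreover have "degree q \<le> m"
  proof (rule degree_le, intro allI impI)
    fix i assume "m < i"
    then show "coeff q i = 0"
      using Suc lead[of n] coeff_eq_0[of "P n" i] degree_P[of n]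
      by (cases "i = n"; cases i) (auto simp: q_def coeff_pderiv)
  qed
  ultimately have "M (q * P m) = - subleading n * h m" by (simp add: M_mult)
  moreover have "pCons 0 (pderiv (P n)) = q + smult (real n) (P n)" by (simp add: q_def)
  then have "M (pCons 0 (pderiv (P n)) * P m) = M (q * P m) + real n * M (P n * P m)"
    by (metis M_add M_smult distrib_right mult_smult_left)
  ultimately have D2: "M (pCons 0 (pderiv (P n)) * P m) = - subleading n * h m"
    using Suc by (simp add: orthogonal)
  have "P n * P m + pCons 0 (pderiv (P n * P m)) =
      P n * P m + (pCons 0 (pderiv (P m)) * P n + pCons 0 (pderiv (P n)) * P m)"
    by (simp add: pderiv_mult mult.commute)
  then have "M (P n * P m + pCons 0 (pderiv (P n * P m))) = - subleading n * h m"
    using D1 D2 Suc by (simp only: M_add) (simp add: orthogonal)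
  moreover have "M (pCons 0 (pCons 0 (P n * P m))) = \<beta> n * (\<alpha> n + \<alpha> m) * h m"
  proof -
    have "pCons 0 (pCons 0 (P n * P m)) = pCons 0 (P n * pCons 0 (P m))" by simp
    also have "M \<dots> = M (pCons 0 (P m * P (n + 1))) + \<alpha> n * M (pCons 0 (P m * P n))
        + \<beta> n * M (pCons 0 (P m * P m))"
      using M_recurrence[of n "pCons 0 (P m)"] Suc by (simp add: mult.commute)
    also have "\<dots> = \<beta> n * (\<alpha> n + \<alpha> m) * h m"
      using h_Suc[of m] Suc \<beta>_0
      by (cases m) (simp_all add: M_recurrence orthogonal algebra_simps)
    finally show ?thesis .
  qed
  moreover have "t * N (P n * P m) = r n * h m"
    using h_nonzero[of m] Suc r_Suc[of m] by simp
  ultimately have "- subleading n * h m = (2 * (\<beta> n * (\<alpha> n + \<alpha> m)) - r n) * h m"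
    using by_parts[of "P n * P m"] Suc by (simp add: orthogonal algebra_simps)
  then show ?thesis using h_nonzero[of m] Suc by (simp only: mult_cancel_right) simp
qed

lemma r_Suc_diff:
  "r (n + 1) - r n =
    2 * \<beta> (n + 1) * (\<alpha> (n + 1) + \<alpha> n) - 2 * \<beta> n * (\<alpha> n + \<alpha> (n - 1)) - \<alpha> n"
  using r_eq[of "n + 1"] r_eq[of n] subleading_Suc[of n] by simp

lemmas r_quadratic = ladder_step(1)[OF \<beta>_0 r_0 R_eq r_Suc_add R_Suc r_Suc_diff]
lemmas r_linear = ladder_step(2)[OF \<beta>_0 r_0 R_eq r_Suc_add R_Suc r_Suc_diff]

end

section \<open>Specialization to the weight and elimination of \<open>r n\<close>\<close>

theorem theorem2p1:
  fixes lam t :: real and P :: "nat \<Rightarrow> real poly" and h \<alpha> \<beta> :: "nat \<Rightarrow> real" and n :: nat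
  assumes "lam \<ge> 0" and "t > 0"
    and "monic_orthogonal_polys lam t P h"
    and "recurrence_coeffs P \<alpha> \<beta>"
    and "n \<ge> 1"
  shows
    "((real n * t - 2 * t * \<beta> n
             - 2 * \<alpha> n * \<beta> n * (2 * (\<alpha> (n - 1))\<^sup>2 + 2 * \<beta> n + 2 * \<beta> (n - 1) - 2 * real n + 1 - lam)
             - 2 * \<alpha> (n - 1) * \<beta> n * (2 * (\<alpha> n)\<^sup>2 + 2 * \<beta> n + 2 * \<beta> (n + 1) - 2 * real n - 1 - lam))
       * ((real n + lam) * t - 2 * t * \<beta> n
             + 2 * \<alpha> n * \<beta> n * (2 * (\<alpha> (n - 1))\<^sup>2 + 2 * \<beta> n + 2 * \<beta> (n - 1) - 2 * real n + 1 - lam)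
             + 2 * \<alpha> (n - 1) * \<beta> n * (2 * (\<alpha> n)\<^sup>2 + 2 * \<beta> n + 2 * \<beta> (n + 1) - 2 * real n - 1 - lam))
       + \<beta> n * (2 * real n + lam - 4 * \<beta> n)\<^sup>2
         * (2 * (\<alpha> (n - 1))\<^sup>2 + 2 * \<beta> n + 2 * \<beta> (n - 1) - 2 * real n + 1 - lam)
         * (2 * (\<alpha> n)\<^sup>2 + 2 * \<beta> n + 2 * \<beta> (n + 1) - 2 * real n - 1 - lam) = 0)
     \<and>
     (2 * (real n * t - 2 * t * \<beta> n
             - 2 * \<alpha> n * \<beta> n * (2 * (\<alpha> (n - 1))\<^sup>2 + 2 * \<beta> n + 2 * \<beta> (n - 1) - 2 * real n + 1 - lam)
             - 2 * \<alpha> (n - 1) * \<beta> n * (2 * (\<alpha> n)\<^sup>2 + 2 * \<beta> n + 2 * \<beta> (n + 1) - 2 * real n - 1 - lam))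
       + (2 * real n + lam - 4 * \<beta> n)
         * (2 * (\<alpha> n) ^ 3 - (2 * real n + 2 + lam) * \<alpha> n - t + 4 * \<alpha> n * \<beta> (n + 1)
            - 2 * \<alpha> (n - 1) * \<beta> n + 2 * \<alpha> (n + 1) * \<beta> (n + 1)) = 0)"
proof -
  have degree: "degree (P k) = k" and monic: "lead_coeff (P k) = 1" for k
    using assms(3) unfolding monic_orthogonal_polys_def by blast+
  have orth: "weight_moment lam t (P m * P k) = (if m = k then h k else 0)" for m k
    using assms(3) by (simp add: monic_orthogonal_polys_def weight_moment_def)
  have h_pos: "h k > 0" for k
  proof -
    have "P k \<noteq> 0" using monic[of k] by auto
    then show ?thesis using weight_moment_square_pos[OF assms(1,2)] orth[of k k] by metis
  qed
  interpret orthogonal_moments "weight_moment lam t" "weight_divide_moment lam t" lam t P h \<alpha> \<beta>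
  proof
    show "pCons 0 (P k) = P (k + 1) + smult (\<alpha> k) (P k) + smult (\<beta> k) (P (k - 1))" for k
      using assms(4) unfolding recurrence_coeffs_def poly_eq_poly_eq_iff[symmetric] by auto
    show "h k \<noteq> 0" for k using h_pos[of k] by simp
    show "weight_moment lam t (q + pCons 0 (pderiv q)) =
        2 * weight_moment lam t (pCons 0 (pCons 0 q)) - lam * weight_moment lam t q
          - t * weight_divide_moment lam t q" for q
      by (rule weight_moment_by_parts[OF assms(1,2)])
    show "\<beta> 0 = 0" using assms(4) by (simp add: recurrence_coeffs_def)
  qed (rule degree monic orth weight_moment_add[OF assms(1,2)] weight_moment_smult
      weight_divide_moment_add[OF assms(1,2)] weight_divide_moment_smult
      weight_divide_moment_pCons_0)+
  let ?E = "real n * t - 2 * t * \<beta> n - 2 * \<alpha> n * \<beta> n * R (n - 1) - 2 * \<alpha> (n - 1) * \<beta> n * R n"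
  let ?F = "(real n + lam) * t - 2 * t * \<beta> n + 2 * \<alpha> n * \<beta> n * R (n - 1) + 2 * \<alpha> (n - 1) * \<beta> n * R n"
  let ?G = "2 * (\<alpha> n) ^ 3 - (2 * real n + 2 + lam) * \<alpha> n - t + 4 * \<alpha> n * \<beta> (n + 1)
    - 2 * \<alpha> (n - 1) * \<beta> n + 2 * \<alpha> (n + 1) * \<beta> (n + 1)"
  let ?c = "2 * real n + lam - 4 * \<beta> n"
  have E: "?E = r n * ?c" using r_linear[of n] by simp
  \<comment> \<open>\<open>?E\<close> and \<open>?F\<close> add up to \<open>t * ?c\<close>.\<close>
  have F: "?F = (t - r n) * ?c" using r_linear[of n] by (simp add: algebra_simps)
  \<comment> \<open>Subtracting the formula for r_(n+1) - r_n from the one for r_(n+1) + r_n leaves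
    2 r_n.\<close>
  have G: "?G = - 2 * r n"
    using r_Suc_add[of n] r_Suc_diff[of n] unfolding R_eq by simp algebra
  \<comment> \<open>After substitution this is \<open>?c\<^sup>2\<close> times the quadratic
    identity.\<close>
  have "?E * ?F + \<beta> n * ?c\<^sup>2 * R (n - 1) * R n = 0"
    unfolding E F using r_quadratic[of n] by algebra
  moreover have "2 * ?E + ?c * ?G = 0"
    unfolding E G by simp
  moreover have "R n = 2 * (\<alpha> n)\<^sup>2 + 2 * \<beta> n + 2 * \<beta> (n + 1) - 2 * real n - 1 - lam"
    by (rule R_eq)
  \<comment> \<open>Here n \<ge> 1 matters: \<open>real (n - 1)\<close> is
    \<open>real n - 1\<close>, which turns the constant -1 into +1, and \<beta> at (n - 1) + 1 is
    \<open>\<beta> n\<close>.\<close>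
  moreover have "R (n - 1) = 2 * (\<alpha> (n - 1))\<^sup>2 + 2 * \<beta> n + 2 * \<beta> (n - 1) - 2 * real n + 1 - lam"
    using R_eq[of "n - 1"] assms(5) by (simp add: of_nat_diff)
  ultimately show ?thesis by simp
qed

end
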